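(* Let $R$ be a commutative ring with identity, let $M$ be a Noetherian coreduced comultiplication $R$-module, and let $N$ be a $dsz^\circ$-submodule of $M$. Then every maximal second submodule of $N$ (that is, every submodule maximal under inclusion among the second submodules contained in $N$) is a $dsz^\circ$-submodule of $M$. In particular, $sec(N)$ is a $dsz^\circ$-submodule of $M$.
   Context: For an ideal $I$ of $R$, $r\in R$ and a submodule $K$ of $M$: $(0:_MI)=\{m\in M: Im=0\}$, $(K:_Mr)=\{m\in M: rm\in K\}$. $M$ is a comultiplication module if every submodule $N$ of $M$ has the form $N=(0:_MI)$ for some ideal $I$ of $R$. A proper submodule $L$ of $M$ is completely irreducible if $L=\bigcap_{i\in I}N_i$ for a family of submodules $N_i$ of $M$ implies $L=N_i$ for some $i$. $M$ is coreduced if for every $r\in R$ and every completely irreducible submodule $L$ of $M$, $(L:_Mr)=M$ implies $L+(0:_Mr)=M$. A non-zero submodule $S$ of a module is second if for each $a\in R$ multiplication by $a$ on $S$ is either surjective or zero. A maximal second submodule of a module is a second submodule that is maximal under inclusion among the second submodules of that module. For a submodule $K$ of $M$, $\mathfrak{S}_K$ is the sum of all maximal second submodules of $M$ contained in $K$ (and $0$ if there are none). A non-zero submodule $N$ of $M$ is a $dsz^\circ$-submodule of $M$ if $N\subseteq\mathfrak{S}_K$ for every submodule $K$ of $M$ with $N\subseteq K$. $sec(N)$ is the sum of all second submodules of $M$ contained in $N$ (and $0$ if there are none). *)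

theory Defs
  imports "HOL-Algebra.Module" "HOL-Algebra.Ideal"
begin

(* Throughout, a submodule of M is a set N with submodule N R M. *)

definition submodule_gen ::
    "('a, 'c) ring_scheme \<Rightarrow> ('a, 'b, 'd) module_scheme \<Rightarrow> 'b set \<Rightarrow> 'b set" where
  "submodule_gen R M A = \<Inter>{N. submodule N R M \<and> A \<subseteq> N}"

definition noetherian_module ::
    "('a, 'c) ring_scheme \<Rightarrow> ('a, 'b, 'd) module_scheme \<Rightarrow> bool" where
  "noetherian_module R M \<longleftrightarrow> module R M \<and>
     (\<forall>N. submodule N R M \<longrightarrow>
        (\<exists>A. A \<subseteq> carrier M \<and> finite A \<and> N = submodule_gen R M A))"

(* The sum of an arbitrary collection of submodules: all finite sums of elements of its members.
   The empty collection has sum {0}. *)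
definition submodule_sum :: "('a, 'b, 'd) module_scheme \<Rightarrow> 'b set set \<Rightarrow> 'b set" where
  "submodule_sum M \<S> =
     {finsum M f \<F> | f \<F>. finite \<F> \<and> \<F> \<subseteq> \<S> \<and> (\<forall>S\<in>\<F>. f S \<in> S)}"

(* (0 :_M I) *)
definition annihilated_by ::
    "('a, 'b, 'd) module_scheme \<Rightarrow> 'a set \<Rightarrow> 'b set" where
  "annihilated_by M I = {m \<in> carrier M. \<forall>r\<in>I. r \<odot>\<^bsub>M\<^esub> m = \<zero>\<^bsub>M\<^esub>}"

(* (K :_M r); in particular (0 :_M r) is submodule_quot M {0} r *)
definition submodule_quot ::
    "('a, 'b, 'd) module_scheme \<Rightarrow> 'b set \<Rightarrow> 'a \<Rightarrow> 'b set" where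
  "submodule_quot M K r = {m \<in> carrier M. r \<odot>\<^bsub>M\<^esub> m \<in> K}"

definition comultiplication_module ::
    "('a, 'c) ring_scheme \<Rightarrow> ('a, 'b, 'd) module_scheme \<Rightarrow> bool" where
  "comultiplication_module R M \<longleftrightarrow> module R M \<and>
     (\<forall>N. submodule N R M \<longrightarrow> (\<exists>I. ideal I R \<and> N = annihilated_by M I))"

(* Families of submodules are given by their range \<N>; intersecting with carrier M makes the
   intersection of the empty family equal to M. *)
definition completely_irreducible ::
    "('a, 'c) ring_scheme \<Rightarrow> ('a, 'b, 'd) module_scheme \<Rightarrow> 'b set \<Rightarrow> bool" where
  "completely_irreducible R M L \<longleftrightarrow> submodule L R M \<and> L \<noteq> carrier M \<and>
     (\<forall>\<N>. (\<forall>N\<in>\<N>. submodule N R M) \<and> L = carrier M \<inter> \<Inter>\<N> \<longrightarrow> (\<exists>N\<in>\<N>. L = N))"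

definition coreduced_module ::
    "('a, 'c) ring_scheme \<Rightarrow> ('a, 'b, 'd) module_scheme \<Rightarrow> bool" where
  "coreduced_module R M \<longleftrightarrow> module R M \<and>
     (\<forall>r\<in>carrier R. \<forall>L. completely_irreducible R M L \<longrightarrow>
        submodule_quot M L r = carrier M \<longrightarrow>
        L <+>\<^bsub>M\<^esub> submodule_quot M {\<zero>\<^bsub>M\<^esub>} r = carrier M)"

definition second_submodule ::
    "('a, 'c) ring_scheme \<Rightarrow> ('a, 'b, 'd) module_scheme \<Rightarrow> 'b set \<Rightarrow> bool" where
  "second_submodule R M S \<longleftrightarrow> submodule S R M \<and> S \<noteq> {\<zero>\<^bsub>M\<^esub>} \<and>
     (\<forall>a\<in>carrier R. (\<lambda>x. a \<odot>\<^bsub>M\<^esub> x) ` S = S \<or> (\<forall>x\<in>S. a \<odot>\<^bsub>M\<^esub> x = \<zero>\<^bsub>M\<^esub>))"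

(* S is a maximal second submodule of the submodule N of M. The submodules of N are the submodules
   of M contained in N; the maximal second submodules of M itself are the case N = carrier M. *)
definition maximal_second_submodule ::
    "('a, 'c) ring_scheme \<Rightarrow> ('a, 'b, 'd) module_scheme \<Rightarrow> 'b set \<Rightarrow> 'b set \<Rightarrow> bool" where
  "maximal_second_submodule R M N S \<longleftrightarrow> second_submodule R M S \<and> S \<subseteq> N \<and>
     (\<forall>T. second_submodule R M T \<and> T \<subseteq> N \<and> S \<subseteq> T \<longrightarrow> T = S)"

(* The submodule \<SS>_K: maximality is with respect to all of M, not relative to K. *)
definition max_second_sum ::
    "('a, 'c) ring_scheme \<Rightarrow> ('a, 'b, 'd) module_scheme \<Rightarrow> 'b set \<Rightarrow> 'b set" where
  "max_second_sum R M K =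
     submodule_sum M {S. maximal_second_submodule R M (carrier M) S \<and> S \<subseteq> K}"

definition dsz_submodule ::
    "('a, 'c) ring_scheme \<Rightarrow> ('a, 'b, 'd) module_scheme \<Rightarrow> 'b set \<Rightarrow> bool" where
  "dsz_submodule R M N \<longleftrightarrow> submodule N R M \<and> N \<noteq> {\<zero>\<^bsub>M\<^esub>} \<and>
     (\<forall>K. submodule K R M \<and> N \<subseteq> K \<longrightarrow> N \<subseteq> max_second_sum R M K)"

definition sec ::
    "('a, 'c) ring_scheme \<Rightarrow> ('a, 'b, 'd) module_scheme \<Rightarrow> 'b set \<Rightarrow> 'b set" where
  "sec R M N = submodule_sum M {S. second_submodule R M S \<and> S \<subseteq> N}"

end

theory Submission
  imports Defs
begin

text \<open>
  Being a dsz-submodule, N is a sum of maximal second submodules of M, and finite generation lets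
  one replace this by a finite family F. Let S be second in N and suppose S lies in no member
  of F. As M is comultiplication, every T in F is killed by some scalar not killing S, which
  then maps S onto itself; the product of these scalars kills N but maps S onto S, which is absurd.
  So S lies in some member of F, and if S is maximal in N it equals that maximal second submodule
  of M. Moreover \<open>sec N = N\<close>.
\<close>

lemma submodule_sum_mono: "\<S> \<subseteq> \<T> \<Longrightarrow> submodule_sum M \<S> \<subseteq> submodule_sum M \<T>"
  unfolding submodule_sum_def by blast

text \<open>Elements of the sum are finite sums, so the members that supply the summands suffice.
  This is where finiteness of the family will come from.\<close>

lemma submodule_sum_finite_subset:
  assumes "x \<in> submodule_sum M \<S>"
  obtains \<F> where "finite \<F>" "\<F> \<subseteq> \<S>" "x \<in> submodule_sum M \<F>"
  using assms unfolding submodule_sum_def by blast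

context module
begin

lemma submodule_finsum_closed:
  assumes "submodule K R M" "finite F" "\<And>i. i \<in> F \<Longrightarrow> f i \<in> K"
  shows "finsum M f F \<in> K"
proof -
  have sg: "subgroup K (add_monoid M)"
    using assms(1) by (simp add: submodule_def)
  have K: "K \<subseteq> carrier M"
    using assms(1) by (rule submoduleE(1))
  show ?thesis
    using assms(2,3)
  proof (induction F)
    case empty
    then show ?case
      using subgroup.one_closed[OF sg] by simp
  next
    case (insert i F)
    then have "f \<in> F \<rightarrow> carrier M" "f i \<in> carrier M" "finsum M f F \<in> K" "f i \<in> K"
      using K by auto
    then show ?case
      using insert.hyps subgroup.m_closed[OF sg] by simp
  qed
qed

lemma submodule_sum_least:
  assumes "submodule K R M" "\<And>S. S \<in> \<S> \<Longrightarrow> S \<subseteq> K"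
  shows "submodule_sum M \<S> \<subseteq> K"
proof
  fix x
  assume "x \<in> submodule_sum M \<S>"
  then obtain f \<F> where "x = finsum M f \<F>" "finite \<F>" "\<F> \<subseteq> \<S>" "\<forall>S\<in>\<F>. f S \<in> S"
    unfolding submodule_sum_def by blast
  then show "x \<in> K"
    using submodule_finsum_closed[OF assms(1)] assms(2) by (metis subsetD)
qed

lemma submodule_sum_upper:
  assumes "submodule S R M" "S \<in> \<S>"
  shows "S \<subseteq> submodule_sum M \<S>"
proof
  fix x
  assume x: "x \<in> S"
  then have "x \<in> carrier M"
    using submoduleE(1)[OF assms(1)] by blast
  then have "x = finsum M (\<lambda>_. x) {S}"
    by simp
  then show "x \<in> submodule_sum M \<S>"
    unfolding submodule_sum_def using assms(2) x by blast
qed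

text \<open>The kernel of multiplication by \<open>r\<close>. Knowing it is a submodule lets
  vanishing on generators pass to everything they generate.\<close>

lemma submodule_quot_zero:
  assumes "r \<in> carrier R"
  shows "submodule (submodule_quot M {\<zero>\<^bsub>M\<^esub>} r) R M"
proof (rule submoduleI)
  fix a x
  assume a: "a \<in> carrier R" and x: "x \<in> submodule_quot M {\<zero>\<^bsub>M\<^esub>} r"
  then have "r \<odot>\<^bsub>M\<^esub> (a \<odot>\<^bsub>M\<^esub> x) = a \<odot>\<^bsub>M\<^esub> (r \<odot>\<^bsub>M\<^esub> x)"
    using assms smult_assoc1[of r a x] smult_assoc1[of a r x] m_comm[of a r]
    by (simp add: submodule_quot_def)
  then show "a \<odot>\<^bsub>M\<^esub> x \<in> submodule_quot M {\<zero>\<^bsub>M\<^esub>} r"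
    using a x by (simp add: submodule_quot_def)
qed (use assms in \<open>auto simp: submodule_quot_def smult_r_minus smult_r_distr\<close>)

text \<open>Write \<open>T\<close> as the annihilator of an ideal \<open>I\<close>. An element of
  \<open>S\<close> outside \<open>T\<close> is not killed by some \<open>r\<close> in
  \<open>I\<close>, and on a second submodule a scalar that does not act as zero is
  surjective.\<close>

lemma second_separating_scalar:
  assumes comul: "comultiplication_module R M"
    and S: "second_submodule R M S" and T: "submodule T R M" and nle: "\<not> S \<subseteq> T"
  obtains r where "r \<in> carrier R" "(\<lambda>x. r \<odot>\<^bsub>M\<^esub> x) ` S = S" "\<And>x. x \<in> T \<Longrightarrow> r \<odot>\<^bsub>M\<^esub> x = \<zero>\<^bsub>M\<^esub>"
proof -
  obtain I where I: "ideal I R" "T = annihilated_by M I"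
    using comul T unfolding comultiplication_module_def by blast
  have SM: "S \<subseteq> carrier M"
    using S by (simp add: second_submodule_def submoduleE(1))
  obtain x r where xr: "x \<in> S" "r \<in> I" "r \<odot>\<^bsub>M\<^esub> x \<noteq> \<zero>\<^bsub>M\<^esub>"
    using nle SM I(2) unfolding annihilated_by_def by blast
  have r: "r \<in> carrier R"
    using xr(2) ideal.Icarr[OF I(1)] by blast
  have "(\<lambda>x. r \<odot>\<^bsub>M\<^esub> x) ` S = S"
    using S r xr unfolding second_submodule_def by blast
  then show thesis
    using that[OF r] xr(2) I(2) by (simp add: annihilated_by_def)
qed

text \<open>Multiply the scalars obtained for the single members: the product kills whatever one
  factor kills, and a composite of surjections of \<open>S\<close> is surjective.\<close>

lemma second_separating_scalar_finite:
  assumes "comultiplication_module R M" "second_submodule R M S"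
    and "finite \<F>" "\<And>T. T \<in> \<F> \<Longrightarrow> submodule T R M" "\<And>T. T \<in> \<F> \<Longrightarrow> \<not> S \<subseteq> T"
  shows "\<exists>r\<in>carrier R. (\<lambda>x. r \<odot>\<^bsub>M\<^esub> x) ` S = S \<and> (\<forall>T\<in>\<F>. T \<subseteq> submodule_quot M {\<zero>\<^bsub>M\<^esub>} r)"
  using assms(3-5)
proof (induction \<F>)
  case empty
  have "S \<subseteq> carrier M"
    using assms(2) by (simp add: second_submodule_def submoduleE(1))
  \<comment> \<open>The empty product serves as witness for the empty family.\<close>
  then have "(\<lambda>x. \<one> \<odot>\<^bsub>M\<^esub> x) ` S = S"
    by force
  then show ?case
    by blast
next
  case (insert T \<F>)
  then obtain r where r: "r \<in> carrier R" "(\<lambda>x. r \<odot>\<^bsub>M\<^esub> x) ` S = S"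
      "\<forall>T\<in>\<F>. T \<subseteq> submodule_quot M {\<zero>\<^bsub>M\<^esub>} r"
    by auto
  obtain s where s: "s \<in> carrier R" "(\<lambda>x. s \<odot>\<^bsub>M\<^esub> x) ` S = S" "\<And>x. x \<in> T \<Longrightarrow> s \<odot>\<^bsub>M\<^esub> x = \<zero>\<^bsub>M\<^esub>"
    using second_separating_scalar[OF assms(1,2)] insert.prems by (metis insertI1)
  have SM: "S \<subseteq> carrier M"
    using assms(2) by (simp add: second_submodule_def submoduleE(1))
  have "(\<lambda>x. (s \<otimes> r) \<odot>\<^bsub>M\<^esub> x) ` S = (\<lambda>x. s \<odot>\<^bsub>M\<^esub> x) ` (\<lambda>x. r \<odot>\<^bsub>M\<^esub> x) ` S"
    unfolding image_image using SM r(1) s(1) by (intro image_cong) (auto simp: smult_assoc1)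
  then have "(\<lambda>x. (s \<otimes> r) \<odot>\<^bsub>M\<^esub> x) ` S = S"
    using r(2) s(2) by simp
  moreover have "T \<subseteq> submodule_quot M {\<zero>\<^bsub>M\<^esub>} (s \<otimes> r)"
  proof
    fix x
    assume x: "x \<in> T"
    then have "x \<in> carrier M"
      using submoduleE(1)[of T] insert.prems(1) by blast
    \<comment> \<open>The product is commuted so that \<open>s\<close>, which kills
      \<open>T\<close>, acts first.\<close>
    then show "x \<in> submodule_quot M {\<zero>\<^bsub>M\<^esub>} (s \<otimes> r)"
      using r(1) s(1) s(3)[OF x]
      by (simp add: submodule_quot_def m_comm[of s r] smult_assoc1)
  qed
  moreover have "U \<subseteq> submodule_quot M {\<zero>\<^bsub>M\<^esub>} (s \<otimes> r)" if "U \<in> \<F>" for U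
  proof -
    have "U \<subseteq> submodule_quot M {\<zero>\<^bsub>M\<^esub>} r"
      using r(3) that by blast
    then show ?thesis
      using r(1) s(1) by (auto simp: submodule_quot_def smult_assoc1)
  qed
  ultimately show ?case
    using r(1) s(1) by blast
qed

text \<open>Dual to the fact that a prime ideal containing a finite intersection of ideals contains
  one of them. Finite generation of \<open>N\<close> is what allows \<open>\<S>\<close> to be
  infinite.\<close>

lemma second_le_member_of_sum:
  assumes "comultiplication_module R M" "noetherian_module R M"
    and N: "submodule N R M" "N \<subseteq> submodule_sum M \<S>"
    and \<S>: "\<And>T. T \<in> \<S> \<Longrightarrow> submodule T R M"
    and S: "second_submodule R M S" "S \<subseteq> N"
  shows "\<exists>T\<in>\<S>. S \<subseteq> T"
proof (rule ccontr)
  assume nle: "\<not> (\<exists>T\<in>\<S>. S \<subseteq> T)"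
  obtain A where A: "finite A" "N = submodule_gen R M A"
    using assms(2) N(1) unfolding noetherian_module_def by blast
  have "A \<subseteq> N"
    unfolding A(2) submodule_gen_def by blast
  then have "\<forall>a\<in>A. \<exists>\<F>. finite \<F> \<and> \<F> \<subseteq> \<S> \<and> a \<in> submodule_sum M \<F>"
    using N(2) by (meson submodule_sum_finite_subset subsetD)
  then obtain F where F: "\<And>a. a \<in> A \<Longrightarrow> finite (F a) \<and> F a \<subseteq> \<S> \<and> a \<in> submodule_sum M (F a)"
    by metis
  \<comment> \<open>Finitely many members of \<open>\<S>\<close> that together supply the summands
    of every generator of \<open>N\<close>.\<close>
  define \<F> where "\<F> = (\<Union>a\<in>A. F a)"
  have \<F>: "finite \<F>" "\<F> \<subseteq> \<S>"
    using F A(1) by (auto simp: \<F>_def)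
  obtain r where r: "r \<in> carrier R" "(\<lambda>x. r \<odot>\<^bsub>M\<^esub> x) ` S = S"
      "\<forall>T\<in>\<F>. T \<subseteq> submodule_quot M {\<zero>\<^bsub>M\<^esub>} r"
    using second_separating_scalar_finite[OF assms(1) S(1) \<F>(1)] \<S> nle \<F>(2) by blast
  have "A \<subseteq> submodule_quot M {\<zero>\<^bsub>M\<^esub>} r"
  proof
    fix a
    assume a: "a \<in> A"
    then have "submodule_sum M (F a) \<subseteq> submodule_quot M {\<zero>\<^bsub>M\<^esub>} r"
      using r(3) by (intro submodule_sum_least submodule_quot_zero r(1)) (auto simp: \<F>_def)
    then show "a \<in> submodule_quot M {\<zero>\<^bsub>M\<^esub>} r"
      using F[OF a] by blast
  qed
  \<comment> \<open>The kernel of \<open>r\<close> is one of the submodules intersected in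
    \<open>submodule_gen R M A\<close>, so it contains \<open>N\<close> and hence
    \<open>S\<close>.\<close>
  then have "S \<subseteq> submodule_quot M {\<zero>\<^bsub>M\<^esub>} r"
    using S(2) submodule_quot_zero[OF r(1)] unfolding A(2) submodule_gen_def by blast
  then have "(\<lambda>x. r \<odot>\<^bsub>M\<^esub> x) ` S \<subseteq> {\<zero>\<^bsub>M\<^esub>}"
    by (auto simp: submodule_quot_def)
  then have "S \<subseteq> {\<zero>\<^bsub>M\<^esub>}"
    using r(2) by simp
  moreover have "\<zero>\<^bsub>M\<^esub> \<in> S"
    using S(1) subgroup.one_closed[of S "add_monoid M"]
    by (simp add: second_submodule_def submodule_def)
  ultimately show False
    using S(1) by (auto simp: second_submodule_def)
qed

text \<open>Whenever \<open>S\<close> lies in \<open>K\<close>, it is itself one of the summands of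
  \<open>max_second_sum R M K\<close>.\<close>

lemma maximal_second_dsz:
  assumes "maximal_second_submodule R M (carrier M) S"
  shows "dsz_submodule R M S"
proof -
  have "submodule S R M" "S \<noteq> {\<zero>\<^bsub>M\<^esub>}"
    using assms by (auto simp: maximal_second_submodule_def second_submodule_def)
  moreover have "S \<subseteq> max_second_sum R M K" if "S \<subseteq> K" for K
    unfolding max_second_sum_def using assms that \<open>submodule S R M\<close>
    by (intro submodule_sum_upper) auto
  ultimately show ?thesis
    unfolding dsz_submodule_def by blast
qed

text \<open>The dsz condition at \<open>K = N\<close> puts \<open>N\<close> inside a sum of second
  submodules contained in \<open>N\<close>, all of which are summands of
  \<open>sec R M N\<close>.\<close>

lemma dsz_sec_eq:
  assumes "dsz_submodule R M N"
  shows "sec R M N = N"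
proof
  show "sec R M N \<subseteq> N"
    unfolding sec_def using assms by (intro submodule_sum_least) (auto simp: dsz_submodule_def)
  have "N \<subseteq> max_second_sum R M N"
    using assms by (auto simp: dsz_submodule_def)
  also have "\<dots> \<subseteq> sec R M N"
    unfolding max_second_sum_def sec_def
    by (intro submodule_sum_mono) (auto simp: maximal_second_submodule_def)
  finally show "N \<subseteq> sec R M N" .
qed

text \<open>The dsz condition at \<open>K = N\<close> covers \<open>N\<close> by a sum of maximal
  second submodules of \<open>M\<close> that lie in \<open>N\<close>. One of them contains
  \<open>S\<close>, and since it lies in \<open>N\<close>, maximality of \<open>S\<close> there
  forces equality.\<close>

lemma dsz_maximal_second:
  assumes "comultiplication_module R M" "noetherian_module R M" "dsz_submodule R M N"
    and S: "maximal_second_submodule R M N S"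
  shows "maximal_second_submodule R M (carrier M) S"
proof -
  let ?\<S> = "{S. maximal_second_submodule R M (carrier M) S \<and> S \<subseteq> N}"
  have N: "submodule N R M" "N \<subseteq> submodule_sum M ?\<S>"
    using assms(3) by (auto simp: dsz_submodule_def max_second_sum_def)
  have "second_submodule R M S" "S \<subseteq> N"
    using S by (auto simp: maximal_second_submodule_def)
  then have "\<exists>T\<in>?\<S>. S \<subseteq> T"
    by (intro second_le_member_of_sum[OF assms(1,2) N])
      (auto simp: maximal_second_submodule_def second_submodule_def)
  then obtain T where T: "maximal_second_submodule R M (carrier M) T" "T \<subseteq> N" "S \<subseteq> T"
    by blast
  then have "T = S"
    using S by (auto simp: maximal_second_submodule_def)
  then show ?thesis
    using T(1) by simp
qed

end

theorem theorem3p14: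
  fixes R :: "('a, 'c) ring_scheme" and M :: "('a, 'b, 'd) module_scheme"
  assumes "cring R" and "module R M"
    and "noetherian_module R M"
    and "coreduced_module R M"
    and "comultiplication_module R M"
    and "dsz_submodule R M N"
  shows "(\<forall>S. maximal_second_submodule R M N S \<longrightarrow> dsz_submodule R M S) \<and>
    dsz_submodule R M (sec R M N)"
proof -
  interpret module R M
    by (rule assms(2))
  \<comment> \<open>The first claim passes through maximality in \<open>M\<close>; the second is the
    hypothesis on \<open>N\<close> rewritten along \<open>sec R M N = N\<close>.\<close>
  show ?thesis
    using maximal_second_dsz dsz_maximal_second[OF assms(5,3,6)] dsz_sec_eq[OF assms(6)] assms(6)
    by simp
qed

end
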